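(* Suppose that $f:\mathbb{R}^d\to\mathbb{R}$ is convex and differentiable with locally Lipschitz gradient $\nabla f$, and that $\min_{x\in\mathbb{R}^d} f(x)$ has a solution; let $f_*$ be the optimal value. Let $(x^k)$, $(\lambda_k)$, $(\theta_k)$ be generated by the adaptive gradient descent algorithm described in the context. Then $(x^k)$ converges to a solution of $\min_{x\in\mathbb{R}^d} f(x)$, and for every solution $x^*$ and every $k\ge 1$ $$f(\hat x^k)-f_*\le \frac{D}{2S_k}=\mathcal{O}\Bigl(\frac1k\Bigr),$$ where $$\hat x^k=\frac{\lambda_k(1+\theta_k)x^k+\sum_{i=1}^{k-1}w_i x^i}{S_k},\qquad w_i=\lambda_i(1+\theta_i)-\lambda_{i+1}\theta_{i+1},$$ $$S_k=\lambda_k(1+\theta_k)+\sum_{i=1}^{k-1}w_i=\sum_{i=1}^k\lambda_i+\lambda_1\theta_1,$$ and $$D=\|x^1-x^*\|^2+\tfrac12\|x^1-x^0\|^2+2\lambda_1\theta_1\,(f(x^0)-f_* ).$$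
   Context: $\|\cdot\|$ is the Euclidean norm. A mapping is locally Lipschitz if it is Lipschitz on every compact subset of its domain. Adaptive gradient descent algorithm. Input: $x^0\in\mathbb{R}^d$, $\lambda_0>0$, $\theta_0=+\infty$. Set $x^1=x^0-\lambda_0\nabla f(x^0)$. For $k=1,2,\dots$: $$\lambda_k=\min\Bigl\{\sqrt{1+\theta_{k-1}}\,\lambda_{k-1},\ \frac{\|x^k-x^{k-1}\|}{2\|\nabla f(x^k)-\nabla f(x^{k-1})\|}\Bigr\},\qquad x^{k+1}=x^k-\lambda_k\nabla f(x^k),\qquad \theta_k=\frac{\lambda_k}{\lambda_{k-1}}.$$ Conventions: if $\nabla f(x^k)-\nabla f(x^{k-1})=0$, the second term in the minimum is ignored (taken to be $+\infty$). Since $\theta_0=+\infty$, the first term is $+\infty$ for $k=1$; if both terms are $+\infty$ for $k=1$, then $\lambda_1>0$ may be chosen arbitrarily. *)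

theory Defs
  imports "HOL-Analysis.Analysis" "HOL-Library.Landau_Symbols"
begin

definition grad :: "('a::real_inner \<Rightarrow> real) \<Rightarrow> 'a \<Rightarrow> 'a" where
  "grad f x = (THE D. GDERIV f x :> D)"

lemma GDERIV_unique:
  assumes "GDERIV f x :> D" "GDERIV f x :> E"
  shows "D = E"
proof -
  have "(\<lambda>h. inner h D) = (\<lambda>h. inner h E)"
    using assms unfolding gderiv_def by (rule has_derivative_unique)
  then have "inner (D - E) D = inner (D - E) E"
    by (rule fun_cong)
  then have "inner (D - E) (D - E) = 0"
    by (simp add: inner_diff_right)
  then show ?thesis by simp
qed

lemma grad_eqI: "GDERIV f x :> D \<Longrightarrow> grad f x = D"
  unfolding grad_def by (rule the_equality) (auto intro: GDERIV_unique)

lemma GDERIV_grad: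
  fixes f :: "'a::euclidean_space \<Rightarrow> real"
  assumes "f differentiable (at x)"
  shows "GDERIV f x :> grad f x"
proof -
  obtain f' where f': "(f has_derivative f') (at x)"
    using assms unfolding differentiable_def by blast
  interpret linear f'
    using f' by (rule has_derivative_linear)
  have "f' h = inner h (\<Sum>b\<in>Basis. f' b *\<^sub>R b)" for h
  proof -
    have "f' h = f' (\<Sum>b\<in>Basis. inner h b *\<^sub>R b)"
      by (simp add: euclidean_representation)
    also have "\<dots> = (\<Sum>b\<in>Basis. inner h b * f' b)"
      by (simp add: sum scaleR)
    finally show ?thesis
      by (simp add: inner_sum_right mult.commute)
  qed
  then have "f' = (\<lambda>h. inner h (\<Sum>b\<in>Basis. f' b *\<^sub>R b))" by (rule ext)
  then have "GDERIV f x :> (\<Sum>b\<in>Basis. f' b *\<^sub>R b)"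
    using f' unfolding gderiv_def by simp
  then show ?thesis using grad_eqI by metis
qed

definition is_solution :: "('a \<Rightarrow> real) \<Rightarrow> 'a \<Rightarrow> bool" where
  "is_solution f z \<longleftrightarrow> is_arg_min f (\<lambda>_. True) z"

definition opt_value :: "('a \<Rightarrow> real) \<Rightarrow> real" where
  "opt_value f = (INF z. f z)"

definition locally_lipschitz :: "('a::metric_space \<Rightarrow> 'b::metric_space) \<Rightarrow> bool" where
  "locally_lipschitz g \<longleftrightarrow> (\<forall>C. compact C \<longrightarrow> (\<exists>L. L-lipschitz_on C g))"

text \<open>
  The two candidates for the step size. The ratio \<open>t\<close> of the previous steps may be infinite,
  which happens only in the first iteration. In the second candidate the infinite value for
  coinciding gradients makes the minimum ignore it.
\<close>

definition growth_bound :: "ereal \<Rightarrow> real \<Rightarrow> ereal" where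
  "growth_bound t l = (if t = \<infinity> then \<infinity> else ereal (sqrt (1 + real_of_ereal t) * l))"

definition curvature_bound :: "('a::real_inner \<Rightarrow> real) \<Rightarrow> 'a \<Rightarrow> 'a \<Rightarrow> ereal" where
  "curvature_bound f y z =
     (if grad f y - grad f z = 0 then \<infinity>
      else ereal (norm (y - z) / (2 * norm (grad f y - grad f z))))"

text \<open>
  The algorithm is a relation rather than a function because the first step size \<open>lam 1\<close> is an
  arbitrary positive number when both candidates are infinite. For \<open>k \<ge> 2\<close> the first
  candidate is finite, so there the step size is always equal to the minimum.
\<close>

definition adaptive_gd ::
  "('a::real_inner \<Rightarrow> real) \<Rightarrow> (nat \<Rightarrow> 'a) \<Rightarrow> (nat \<Rightarrow> real) \<Rightarrow> (nat \<Rightarrow> ereal) \<Rightarrow> bool" where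
  "adaptive_gd f x lam \<theta> \<longleftrightarrow>
     lam 0 > 0 \<and> \<theta> 0 = \<infinity> \<and>
     x 1 = x 0 - lam 0 *\<^sub>R grad f (x 0) \<and>
     (\<forall>k\<ge>1.
        (let m = min (growth_bound (\<theta> (k - 1)) (lam (k - 1)))
                     (curvature_bound f (x k) (x (k - 1)))
         in if m = \<infinity> then lam k > 0 else ereal (lam k) = m) \<and>
        x (k + 1) = x k - lam k *\<^sub>R grad f (x k) \<and>
        \<theta> k = ereal (lam k / lam (k - 1)))"

text \<open>
  Only \<open>\<theta> i\<close> with \<open>i \<ge> 1\<close>, which is finite along the algorithm, is used below, so
  \<^const>\<open>real_of_ereal\<close> loses no information.
\<close>

definition weight :: "(nat \<Rightarrow> real) \<Rightarrow> (nat \<Rightarrow> ereal) \<Rightarrow> nat \<Rightarrow> real" where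
  "weight lam \<theta> i =
     lam i * (1 + real_of_ereal (\<theta> i)) - lam (i + 1) * real_of_ereal (\<theta> (i + 1))"

definition weight_sum :: "(nat \<Rightarrow> real) \<Rightarrow> (nat \<Rightarrow> ereal) \<Rightarrow> nat \<Rightarrow> real" where
  "weight_sum lam \<theta> k =
     lam k * (1 + real_of_ereal (\<theta> k)) + (\<Sum>i=1..k-1. weight lam \<theta> i)"

definition averaged_iterate ::
  "(nat \<Rightarrow> 'a::real_vector) \<Rightarrow> (nat \<Rightarrow> real) \<Rightarrow> (nat \<Rightarrow> ereal) \<Rightarrow> nat \<Rightarrow> 'a" where
  "averaged_iterate x lam \<theta> k =
     ((lam k * (1 + real_of_ereal (\<theta> k))) *\<^sub>R x k + (\<Sum>i=1..k-1. weight lam \<theta> i *\<^sub>R x i))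
       /\<^sub>R weight_sum lam \<theta> k"

definition init_const ::
  "('a::real_inner \<Rightarrow> real) \<Rightarrow> (nat \<Rightarrow> 'a) \<Rightarrow> (nat \<Rightarrow> real) \<Rightarrow> (nat \<Rightarrow> ereal) \<Rightarrow> 'a \<Rightarrow> real" where
  "init_const f x lam \<theta> z =
     (norm (x 1 - z))\<^sup>2 + 1 / 2 * (norm (x 1 - x 0))\<^sup>2
       + 2 * lam 1 * real_of_ereal (\<theta> 1) * (f (x 0) - opt_value f)"

end

theory Submission
  imports Defs
begin

text \<open>
  The proof rests on one quantity that decreases along the iteration. Write
  \<open>g\<close> for the gradient, \<open>d\<^sub>k = x (k + 1) - x k\<close> and
  \<open>c\<^sub>k = lam (k + 1) ^ 2 / lam k\<close>, and for a minimizer \<open>z\<close> let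
  \<open>E z k = |x (k + 1) - z|^2 + |d\<^sub>k|^2 / 2 + 2 c\<^sub>k (f (x k) - f z)\<close>.
  Expanding \<open>|x (k + 2) - z|^2\<close> by the step rule produces the term \<open>|d\<^sub>k\<^sub>+\<^sub>1|^2\<close>,
  which ordinary gradient descent controls by a global Lipschitz constant. Here it is controlled by
  the past instead (\<open>displacement_bound\<close>): the curvature bound on the step size makes
  the change of the gradient along \<open>d\<^sub>k\<close> small, and convexity turns the remaining inner
  product with \<open>g (x k)\<close> into a difference of function values. Together this shows
  (\<open>energy_decrease\<close>) that \<open>E z\<close> drops in every step by at least
  \<open>2 w (f (x (k + 1)) - f z) + 2 lam (k + 1) B\<close>. The weight \<open>w\<close> is
  nonnegative precisely because of the growth bound on the step size, and
  \<open>B\<close> is the gap at \<open>z\<close> between \<open>f\<close> and its tangent at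
  \<open>x (k + 1)\<close>.

  Telescoping and the tangent inequality at the averaged point give the bound by \<open>D / (2 S)\<close>
  (\<open>averaged_gap_bound\<close>). As \<open>E z\<close> is bounded, so are the iterates. The gradient
  is therefore Lipschitz on them, the steps stay above a positive constant
  (\<open>steps_bounded_below\<close>), and \<open>S\<close> grows at least linearly.

  For the convergence of the iterates, the tangent gaps \<open>B\<close> are summable, hence tend to
  \<open>0\<close>. At a cluster point \<open>l\<close> the tangent of \<open>f\<close> thus touches \<open>f\<close> at
  the minimizer \<open>z\<close> as well. Its slope is then a subgradient at \<open>z\<close>, where the only
  subgradient is \<open>0\<close>, so that \<open>l\<close> is a minimizer
  (\<open>cluster_point_minimal\<close>). Finally \<open>E z k\<close> is \<open>|x (k + 1) - z|^2\<close> plus a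
  term that is the same for all minimizers \<open>z\<close>, and it converges for each of them; by Opial's
  argument (\<open>opial_LIMSEQ\<close>) there is only one cluster point.
\<close>

section \<open>Gradients of convex functions\<close>

text \<open>
  Restricting \<open>f\<close> to the line through \<open>u\<close> and \<open>v\<close> reduces this to the
  one-dimensional case.
\<close>

lemma convex_above_tangent:
  fixes f :: "'a::real_inner \<Rightarrow> real"
  assumes "convex_on UNIV f" and "GDERIV f u :> D"
  shows "f u + inner D (v - u) \<le> f v"
proof -
  define p where "p t = f (u + t *\<^sub>R (v - u))" for t :: real
  have "convex_on UNIV p"
  proof (rule convex_onI)
    fix t s r :: real
    assume t: "0 < t" "t < 1"
    have "u + ((1 - t) *\<^sub>R s + t *\<^sub>R r) *\<^sub>R (v - u)
        = (1 - t) *\<^sub>R (u + s *\<^sub>R (v - u)) + t *\<^sub>R (u + r *\<^sub>R (v - u))"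
      by (simp add: algebra_simps)
    then show "p ((1 - t) *\<^sub>R s + t *\<^sub>R r) \<le> (1 - t) * p s + t * p r"
      using convex_onD[OF assms(1), of t "u + s *\<^sub>R (v - u)" "u + r *\<^sub>R (v - u)"] t
      by (simp add: p_def)
  qed simp
  moreover have "((\<lambda>t. f (u + t *\<^sub>R (v - u))) has_derivative (\<lambda>t. inner (t *\<^sub>R (v - u)) D)) (at 0)"
    by (rule has_derivative_compose[where f = "\<lambda>t. u + t *\<^sub>R (v - u)" and g = f and
          g' = "\<lambda>h. inner h D"])
       (use assms(2) in \<open>auto simp: gderiv_def intro!: derivative_eq_intros\<close>)
  then have "(p has_real_derivative inner D (v - u)) (at 0)"
    by (simp add: has_field_derivative_def p_def[abs_def] inner_commute mult_commute_abs)
  ultimately have "inner D (v - u) * (1 - 0) \<le> p 1 - p 0"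
    by (intro convex_on_imp_above_tangent[of UNIV]) auto
  then show ?thesis by (simp add: p_def)
qed

text \<open>
  Subtracting the linear function with slope \<open>s\<close> leaves a function that is minimal at
  \<open>u\<close>, so its derivative vanishes there.
\<close>

lemma subgradient_eq_GDERIV:
  fixes f :: "'a::real_inner \<Rightarrow> real"
  assumes "GDERIV f u :> D" and "\<And>v. f u + inner s (v - u) \<le> f v"
  shows "s = D"
proof -
  have "((\<lambda>v. f v - inner s v) has_derivative (\<lambda>h. inner h D - inner s h)) (at u)"
    using assms(1) unfolding gderiv_def by (auto intro!: derivative_eq_intros)
  moreover have "\<forall>v\<in>UNIV. f u - inner s u \<le> f v - inner s v"
  proof
    fix v show "f u - inner s u \<le> f v - inner s v"
      using assms(2)[of v] by (simp add: inner_diff_right)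
  qed
  ultimately have "(\<lambda>h. inner h D - inner s h) = (\<lambda>h. 0)"
    by (intro differential_zero_maxmin[of u UNIV]) auto
  then have "inner (D - s) D - inner s (D - s) = 0"
    by (rule fun_cong)
  then have "inner (D - s) (D - s) = 0"
    by (simp add: algebra_simps inner_commute)
  then show ?thesis by simp
qed

section \<open>Convergence from distances to the cluster points\<close>

lemma unique_cluster_point_imp_LIMSEQ:
  fixes x :: "nat \<Rightarrow> 'a::heine_borel"
  assumes "bounded (range x)"
    and "\<And>r l'. strict_mono r \<Longrightarrow> (x \<circ> r) \<longlonglongrightarrow> l' \<Longrightarrow> l' = l"
  shows "x \<longlonglongrightarrow> l"
proof (rule ccontr)
  assume "\<not> x \<longlonglongrightarrow> l"
  then obtain e where "e > 0" and e: "\<And>N. \<exists>n\<ge>N. e \<le> dist (x n) l"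
    unfolding lim_sequentially by (meson not_less)
  then have "infinite {n. e \<le> dist (x n) l}"
    unfolding infinite_nat_iff_unbounded_le by auto
  then obtain r :: "nat \<Rightarrow> nat" where r: "strict_mono r" and far: "\<And>n. e \<le> dist (x (r n)) l"
    using infinite_enumerate by blast
  have "bounded (range (x \<circ> r))"
    using assms(1) by (rule bounded_subset) auto
  then obtain l' s where s: "strict_mono s" and lim: "(x \<circ> r \<circ> s) \<longlonglongrightarrow> l'"
    using bounded_imp_convergent_subsequence by blast
  have "l' = l"
    using assms(2)[of "r \<circ> s" l'] strict_mono_o[OF r s] lim by (simp add: o_assoc)
  then have "eventually (\<lambda>n. dist ((x \<circ> r \<circ> s) n) l < e) sequentially"
    using tendstoD[OF lim \<open>e > 0\<close>] by simp
  then show False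
    using far by (auto simp: eventually_sequentially not_less[symmetric])
qed

text \<open>
  For two cluster points \<open>l\<close> and \<open>l'\<close> the unknown sequence \<open>b\<close> cancels in the difference of
  the two convergent sequences, which is an affine function of \<open>x k\<close> with linear part
  \<open>2 (l' - l)\<close>. Its limit can be computed along either subsequence, and comparing the two
  values gives \<open>|l' - l|^2 = 0\<close>.
\<close>

lemma opial_LIMSEQ:
  fixes x :: "nat \<Rightarrow> 'a::{real_inner, heine_borel}"
  assumes bdd: "bounded (range x)"
    and cluster: "\<And>r l. strict_mono r \<Longrightarrow> (x \<circ> r) \<longlonglongrightarrow> l \<Longrightarrow> l \<in> S"
    and conv: "\<And>z. z \<in> S \<Longrightarrow> convergent (\<lambda>k. (norm (x k - z))\<^sup>2 + b k)"
  shows "\<exists>z\<in>S. x \<longlonglongrightarrow> z"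
proof -
  obtain l r where r: "strict_mono r" and l: "(x \<circ> r) \<longlonglongrightarrow> l"
    using bounded_imp_convergent_subsequence[OF bdd] by blast
  have "l' = l" if s: "strict_mono s" and l': "(x \<circ> s) \<longlonglongrightarrow> l'" for s l'
  proof -
    have "convergent (\<lambda>k. ((norm (x k - l))\<^sup>2 + b k) - ((norm (x k - l'))\<^sup>2 + b k))"
      using conv cluster r l s l' by (intro convergent_diff) auto
    moreover have "((norm (x k - l))\<^sup>2 + b k) - ((norm (x k - l'))\<^sup>2 + b k)
        = 2 * inner (x k) (l' - l) + (inner l l - inner l' l')" for k
      by (simp add: power2_norm_eq_inner inner_diff_left inner_diff_right inner_commute)
    ultimately obtain c where c: "(\<lambda>k. 2 * inner (x k) (l' - l) + (inner l l - inner l' l')) \<longlonglongrightarrow> c"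
      unfolding convergent_def by auto
    have lims: "2 * inner y (l' - l) + (inner l l - inner l' l') = c"
      if "strict_mono q" and "(x \<circ> q) \<longlonglongrightarrow> y" for q :: "nat \<Rightarrow> nat" and y
    proof (rule LIMSEQ_unique)
      show "(\<lambda>k. 2 * inner ((x \<circ> q) k) (l' - l) + (inner l l - inner l' l'))
          \<longlonglongrightarrow> 2 * inner y (l' - l) + (inner l l - inner l' l')"
        by (intro tendsto_intros that)
      show "(\<lambda>k. 2 * inner ((x \<circ> q) k) (l' - l) + (inner l l - inner l' l')) \<longlonglongrightarrow> c"
        using LIMSEQ_subseq_LIMSEQ[OF c that(1)] by (simp add: o_def)
    qed
    have "inner (l' - l) (l' - l) = 0"
      using lims[OF r l] lims[OF s l'] by (simp add: inner_diff_left)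
    then show ?thesis by simp
  qed
  then have "x \<longlonglongrightarrow> l"
    by (rule unique_cluster_point_imp_LIMSEQ[OF bdd])
  then show ?thesis
    using cluster[OF r l] by blast
qed

section \<open>The energy of adaptive gradient descent\<close>

text \<open>
  The recursion, with the choice of the step size replaced by its consequences. The
  growth bound starts at \<open>lam 2\<close>, since \<open>lam 1\<close> is not limited by \<open>lam 0\<close>; for the
  same reason a decrease of the step size forces equality in the curvature bound only from
  \<open>lam 2\<close> on. The growth factor is at least \<open>1\<close>, so only the curvature bound
  can make a step shorter.
\<close>

locale adaptive_steps =
  fixes f :: "'a::real_inner \<Rightarrow> real" and g :: "'a \<Rightarrow> 'a"
    and x :: "nat \<Rightarrow> 'a" and lam :: "nat \<Rightarrow> real"
  assumes subgradient: "f u + inner (g u) (v - u) \<le> f v"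
    and lam_pos: "lam k > 0"
    and step: "x (Suc k) = x k - lam k *\<^sub>R g (x k)"
    and growth: "lam (Suc (Suc k)) \<le> sqrt (1 + lam (Suc k) / lam k) * lam (Suc k)"
    and curvature: "2 * lam (Suc k) * norm (g (x (Suc k)) - g (x k)) \<le> norm (x (Suc k) - x k)"
    and decrease: "lam (Suc (Suc k)) < lam (Suc k) \<Longrightarrow>
      g (x (Suc (Suc k))) \<noteq> g (x (Suc k)) \<and>
      2 * lam (Suc (Suc k)) * norm (g (x (Suc (Suc k))) - g (x (Suc k)))
        = norm (x (Suc (Suc k)) - x (Suc k))"
begin

text \<open>
  The product \<open>lam (k + 1) * \<theta> (k + 1)\<close>: the weight with which the previous function
  value enters step \<open>k + 1\<close>.
\<close>

definition carry :: "nat \<Rightarrow> real" where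
  "carry k = (lam (Suc k))\<^sup>2 / lam k"

text \<open>
  The algorithm's weight of index \<open>k + 1\<close>: what remains of the function value at
  \<open>x (k + 1)\<close> after the share \<open>carry (k + 1)\<close> is handed on to the next step.
\<close>

definition gap :: "nat \<Rightarrow> real" where
  "gap k = lam (Suc k) + carry k - carry (Suc k)"

definition bregman :: "'a \<Rightarrow> nat \<Rightarrow> real" where
  "bregman z k = f z - f (x k) - inner (g (x k)) (z - x k)"

definition energy :: "'a \<Rightarrow> nat \<Rightarrow> real" where
  "energy z k = (norm (x (Suc k) - z))\<^sup>2 + 1 / 2 * (norm (x (Suc k) - x k))\<^sup>2
     + 2 * carry k * (f (x k) - f z)"

lemma carry_nonneg: "carry k \<ge> 0"
  using lam_pos[of k] by (simp add: carry_def)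

lemma bregman_nonneg: "bregman z k \<ge> 0"
  using subgradient[of "x k" z] by (simp add: bregman_def)

lemma gap_nonneg: "gap k \<ge> 0"
proof -
  have "1 + lam (Suc k) / lam k \<ge> 0"
    using lam_pos[of k] lam_pos[of "Suc k"] by simp
  then have "(lam (Suc (Suc k)))\<^sup>2 \<le> (1 + lam (Suc k) / lam k) * (lam (Suc k))\<^sup>2"
    using power_mono[OF growth[of k], of 2] lam_pos[of "Suc (Suc k)"]
    by (simp add: power_mult_distrib)
  then have "carry (Suc k) \<le> (1 + lam (Suc k) / lam k) * (lam (Suc k))\<^sup>2 / lam (Suc k)"
    using lam_pos[of "Suc k"] unfolding carry_def by (intro divide_right_mono) auto
  also have "\<dots> = lam (Suc k) + carry k"
    using lam_pos[of k] lam_pos[of "Suc k"]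
    by (simp add: carry_def field_simps power2_eq_square)
  finally show ?thesis by (simp add: gap_def)
qed

text \<open>
  This replaces the descent lemma. By the step rule \<open>|d|^2 = - lam (k + 1) \<langle>g (x (k + 1)), d\<rangle>\<close>
  for the new displacement \<open>d\<close>. In twice this identity the gradient is split as
  \<open>(g (x (k + 1)) - g (x k)) + g (x k)\<close>. The curvature bound handles the difference. The
  other part is symmetric: both \<open>d\<close> and the old displacement are multiples of a
  gradient, so \<open>\<langle>g (x k), d\<rangle>\<close> is a multiple of \<open>g (x (k + 1))\<close> paired with the old
  displacement, to which convexity applies.
\<close>

lemma displacement_bound:
  "(norm (x (Suc (Suc k)) - x (Suc k)))\<^sup>2 \<le>
     1 / 2 * (norm (x (Suc k) - x k))\<^sup>2 - 1 / 2 * (norm (x (Suc (Suc k)) - x (Suc k)))\<^sup>2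
     + 2 * carry k * (f (x k) - f (x (Suc k)))"
proof -
  define a where "a = x (Suc k) - x k"
  define d where "d = x (Suc (Suc k)) - x (Suc k)"
  define l where "l = lam (Suc k)"
  have l: "l > 0" using lam_pos[of "Suc k"] by (simp add: l_def)
  have d: "d = - l *\<^sub>R g (x (Suc k))" by (simp add: d_def l_def step[of "Suc k"])
  have a: "a = - lam k *\<^sub>R g (x k)" by (simp add: a_def step[of k])
  have split: "inner d d = - 2 * l * inner (g (x (Suc k)) - g (x k)) d
      - 2 * l * inner (g (x k)) d - inner d d"
    by (simp add: d inner_diff_left algebra_simps)
  have "- 2 * l * inner (g (x (Suc k)) - g (x k)) d
      \<le> 2 * l * (norm (g (x (Suc k)) - g (x k)) * norm d)"
    using mult_left_mono[OF norm_cauchy_schwarz[of "- (g (x (Suc k)) - g (x k))" d], of "2 * l"] l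
    unfolding inner_minus_left norm_minus_cancel by linarith
  also have "\<dots> \<le> norm a * norm d"
    using mult_right_mono[OF curvature[of k], of "norm d"] by (simp add: a_def l_def mult_ac)
  also have "\<dots> \<le> 1 / 2 * (norm a)\<^sup>2 + 1 / 2 * (norm d)\<^sup>2"
    using sum_squares_bound[of "norm a" "norm d"] by simp
  finally have first: "- 2 * l * inner (g (x (Suc k)) - g (x k)) d
      \<le> 1 / 2 * (norm a)\<^sup>2 + 1 / 2 * (norm d)\<^sup>2" .
  have "g (x k) = - (1 / lam k) *\<^sub>R a"
    using lam_pos[of k] by (simp add: a)
  then have "- 2 * l * inner (g (x k)) d = 2 * carry k * (- inner (g (x (Suc k))) a)"
    using lam_pos[of k] by (simp add: d carry_def l_def power2_eq_square inner_commute)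
  also have "\<dots> \<le> 2 * carry k * (f (x k) - f (x (Suc k)))"
    using subgradient[of "x (Suc k)" "x k"] carry_nonneg[of k]
    by (intro mult_left_mono) (auto simp: a_def inner_diff_right)
  finally show ?thesis
    using split first unfolding a_def[symmetric] d_def[symmetric]
    by (simp add: power2_norm_eq_inner)
qed

lemma energy_step:
  "(norm (x (Suc (Suc k)) - z))\<^sup>2 + 1 / 2 * (norm (x (Suc (Suc k)) - x (Suc k)))\<^sup>2
     + 2 * (lam (Suc k) + carry k) * (f (x (Suc k)) - f z)
     + 2 * lam (Suc k) * bregman z (Suc k) \<le> energy z k"
proof -
  define d where "d = x (Suc (Suc k)) - x (Suc k)"
  have d: "d = - lam (Suc k) *\<^sub>R g (x (Suc k))" by (simp add: d_def step[of "Suc k"])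
  have "x (Suc (Suc k)) - z = (x (Suc k) - z) + d" by (simp add: d_def)
  then have "(norm (x (Suc (Suc k)) - z))\<^sup>2
      = (norm (x (Suc k) - z))\<^sup>2 + 2 * inner (x (Suc k) - z) d + (norm d)\<^sup>2"
    by (simp only: power2_norm_eq_inner inner_add_left inner_add_right inner_commute)
  also have "2 * inner (x (Suc k) - z) d
      = - 2 * lam (Suc k) * (f (x (Suc k)) - f z) - 2 * lam (Suc k) * bregman z (Suc k)"
    by (simp add: d bregman_def inner_diff_left inner_diff_right inner_commute algebra_simps)
  finally have "(norm (x (Suc (Suc k)) - z))\<^sup>2 = (norm (x (Suc k) - z))\<^sup>2
      - 2 * lam (Suc k) * (f (x (Suc k)) - f z) - 2 * lam (Suc k) * bregman z (Suc k)
      + (norm d)\<^sup>2" by simp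
  then show ?thesis
    using displacement_bound[of k] unfolding d_def energy_def by (simp add: algebra_simps)
qed

lemma energy_decrease:
  "energy z (Suc k) + 2 * gap k * (f (x (Suc k)) - f z)
     + 2 * lam (Suc k) * bregman z (Suc k) \<le> energy z k"
  using energy_step[of k z] by (simp add: energy_def gap_def algebra_simps)

lemma energy_telescope:
  "energy z k + 2 * (\<Sum>i<k. gap i * (f (x (Suc i)) - f z))
     + 2 * (\<Sum>i<k. lam (Suc i) * bregman z (Suc i)) \<le> energy z 0"
proof (induction k)
  case (Suc k)
  then show ?case using energy_decrease[of z k] by (simp add: algebra_simps)
qed simp

lemma weighted_gap_bound:
  "2 * ((lam (Suc m) + carry m) * (f (x (Suc m)) - f z)
     + (\<Sum>i<m. gap i * (f (x (Suc i)) - f z))) \<le> energy z 0"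
proof -
  have "2 * (lam (Suc m) + carry m) * (f (x (Suc m)) - f z) \<le> energy z m"
    using energy_step[of m z] mult_nonneg_nonneg[OF less_imp_le[OF lam_pos[of "Suc m"]] bregman_nonneg[of z "Suc m"]]
      zero_le_power2[of "norm (x (Suc (Suc m)) - z)"]
      zero_le_power2[of "norm (x (Suc (Suc m)) - x (Suc m))"]
    by linarith
  moreover have "0 \<le> (\<Sum>i<m. lam (Suc i) * bregman z (Suc i))"
    using lam_pos bregman_nonneg by (intro sum_nonneg mult_nonneg_nonneg) (auto intro: less_imp_le)
  ultimately show ?thesis
    using energy_telescope[of z m] by (simp add: algebra_simps)
qed

lemma sum_gap: "lam (Suc m) + carry m + (\<Sum>i<m. gap i) = (\<Sum>i\<le>m. lam (Suc i)) + carry 0"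
  by (induction m) (simp_all add: gap_def)

context
  fixes z assumes minimal: "\<And>v. f z \<le> f v"
begin

lemma energy_nonneg: "energy z k \<ge> 0"
  using minimal[of "x k"] carry_nonneg[of k] by (simp add: energy_def)

lemma decseq_energy: "decseq (energy z)"
proof (rule decseq_SucI)
  fix k
  have "0 \<le> gap k * (f (x (Suc k)) - f z)"
    using gap_nonneg[of k] minimal[of "x (Suc k)"] by simp
  moreover have "0 \<le> lam (Suc k) * bregman z (Suc k)"
    using lam_pos[of "Suc k"] bregman_nonneg[of z "Suc k"] by simp
  ultimately show "energy z (Suc k) \<le> energy z k"
    using energy_decrease[of z k] by linarith
qed

lemma convergent_energy: "convergent (energy z)"
proof -
  obtain L where "energy z \<longlonglongrightarrow> L"
    using decseq_convergent[OF decseq_energy, of 0] energy_nonneg by blast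
  then show ?thesis by (rule convergentI)
qed

lemma bounded_iterates: "bounded (range x)"
proof -
  have "norm (x (Suc k) - z) \<le> sqrt (energy z 0)" for k
  proof (rule real_le_rsqrt)
    have "0 \<le> carry k * (f (x k) - f z)"
      using minimal[of "x k"] carry_nonneg[of k] by simp
    then have "(norm (x (Suc k) - z))\<^sup>2 \<le> energy z k"
      by (simp add: energy_def)
    also have "\<dots> \<le> energy z 0"
      using decseq_energy by (simp add: decseq_def)
    finally show "(norm (x (Suc k) - z))\<^sup>2 \<le> energy z 0" .
  qed
  then have "x k \<in> insert (x 0) (cball z (sqrt (energy z 0)))" for k
    by (cases k) (auto simp: dist_norm norm_minus_commute)
  then have "range x \<subseteq> insert (x 0) (cball z (sqrt (energy z 0)))" by blast
  then show ?thesis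
    by (rule bounded_subset[rotated]) simp
qed

end

text \<open>
  A step that gets shorter equals the curvature bound, which is at least \<open>1 / (2 L)\<close>.
\<close>

lemma steps_bounded_below:
  assumes "L-lipschitz_on (range x) g"
  shows "\<exists>c>0. \<forall>k. c \<le> lam (Suc k)"
proof -
  \<comment> \<open>A Lipschitz constant may be \<open>0\<close>; the maximum makes \<open>1 / (2 M)\<close> a positive bound.\<close>
  define M where "M = max L 1"
  have M: "M > 0" by (simp add: M_def)
  have lip: "norm (g (x i) - g (x j)) \<le> M * norm (x i - x j)" for i j
  proof -
    have "norm (g (x i) - g (x j)) \<le> L * norm (x i - x j)"
      using lipschitz_onD[OF assms, of "x i" "x j"] by (simp add: dist_norm)
    also have "\<dots> \<le> M * norm (x i - x j)"
      by (intro mult_right_mono) (auto simp: M_def)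
    finally show ?thesis .
  qed
  define c where "c = min (lam 1) (1 / (2 * M))"
  have "c \<le> lam (Suc k)" for k
  proof (induction k)
    case 0
    show ?case by (simp add: c_def)
  next
    case (Suc k)
    show ?case
    proof (cases "lam (Suc (Suc k)) < lam (Suc k)")
      case True
      define d where "d = norm (g (x (Suc (Suc k))) - g (x (Suc k)))"
      have "d > 0" and d: "2 * lam (Suc (Suc k)) * d = norm (x (Suc (Suc k)) - x (Suc k))"
        using decrease[OF True] by (auto simp: d_def)
      have "1 * d \<le> (2 * M * lam (Suc (Suc k))) * d"
        using lip[of "Suc (Suc k)" "Suc k"] d by (simp add: d_def[symmetric] mult_ac)
      then have "1 \<le> 2 * M * lam (Suc (Suc k))"
        using \<open>d > 0\<close> by (simp only: mult_le_cancel_right_pos)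
      then have "1 / (2 * M) \<le> lam (Suc (Suc k))"
        using M by (simp add: field_simps)
      then show ?thesis by (simp add: c_def)
    qed (use Suc in simp)
  qed
  moreover have "c > 0" using M lam_pos[of 1] by (simp add: c_def)
  ultimately show ?thesis by blast
qed

text \<open>
  In the telescoped energy the function values carry weights that may vanish, but the tangent
  gaps carry the steps, which are bounded below. Hence the tangent gaps are summable.
\<close>

lemma bregman_tendsto_zero:
  assumes "\<And>v. f z \<le> f v" and "c > 0" and "\<And>k. c \<le> lam (Suc k)"
  shows "bregman z \<longlonglongrightarrow> 0"
proof -
  have "(\<Sum>i<k. bregman z (Suc i)) \<le> energy z 0 / (2 * c)" for k
  proof -
    have "c * (\<Sum>i<k. bregman z (Suc i)) \<le> (\<Sum>i<k. lam (Suc i) * bregman z (Suc i))"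
      unfolding sum_distrib_left
      using assms(3) bregman_nonneg by (intro sum_mono mult_right_mono) auto
    moreover have "0 \<le> (\<Sum>i<k. gap i * (f (x (Suc i)) - f z))"
      using gap_nonneg assms(1) by (intro sum_nonneg mult_nonneg_nonneg) auto
    ultimately have "2 * (c * (\<Sum>i<k. bregman z (Suc i))) \<le> energy z 0"
      using energy_telescope[of z k] energy_nonneg[OF assms(1), of k] by linarith
    then show ?thesis using \<open>c > 0\<close> by (simp add: field_simps)
  qed
  then have "summable (\<lambda>k. bregman z (Suc k))"
    using bregman_nonneg by (intro summableI_nonneg_bounded) auto
  then show ?thesis
    using summable_LIMSEQ_zero filterlim_sequentially_Suc by blast
qed

text \<open>
  In the limit the tangent at \<open>l\<close> meets \<open>f\<close> at the minimizer \<open>z\<close>, so its slope \<open>g l\<close> is a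
  subgradient at \<open>z\<close>. So is \<open>0\<close>, and both equal \<open>g z\<close>.
\<close>

lemma cluster_point_minimal:
  assumes deriv: "\<And>u. GDERIV f u :> g u" and cont: "continuous_on UNIV g"
    and min: "\<And>v. f z \<le> f v" and breg: "bregman z \<longlonglongrightarrow> 0"
    and r: "strict_mono r" and l: "(x \<circ> r) \<longlonglongrightarrow> l"
  shows "f l \<le> f v"
proof -
  have "isCont f l" using deriv[of l] has_derivative_continuous unfolding gderiv_def by blast
  then have fl: "(\<lambda>k. f ((x \<circ> r) k)) \<longlonglongrightarrow> f l"
    using l by (rule isCont_tendsto_compose)
  have "isCont g l" using cont by (simp add: continuous_on_eq_continuous_at)
  then have gl: "(\<lambda>k. g ((x \<circ> r) k)) \<longlonglongrightarrow> g l"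
    using l by (rule isCont_tendsto_compose)
  have "(\<lambda>k. f z - f ((x \<circ> r) k) - inner (g ((x \<circ> r) k)) (z - (x \<circ> r) k))
      \<longlonglongrightarrow> f z - f l - inner (g l) (z - l)"
    by (intro tendsto_intros fl gl l)
  moreover have "(\<lambda>k. f z - f ((x \<circ> r) k) - inner (g ((x \<circ> r) k)) (z - (x \<circ> r) k)) \<longlonglongrightarrow> 0"
    using LIMSEQ_subseq_LIMSEQ[OF breg r] by (simp add: o_def bregman_def)
  ultimately have touch: "f z - f l - inner (g l) (z - l) = 0"
    by (rule LIMSEQ_unique)
  have "f z + inner (g l) (v - z) \<le> f v" for v
    using subgradient[of l v] touch by (simp add: inner_diff_right)
  then have "g l = g z" by (rule subgradient_eq_GDERIV[OF deriv])
  moreover have "0 = g z"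
    by (rule subgradient_eq_GDERIV[OF deriv]) (simp add: min)
  ultimately show ?thesis using subgradient[of l v] by simp
qed

text \<open>
  Jensen's inequality for the averaged point \<open>y m\<close>, obtained by adding up the tangent
  inequalities at \<open>y m\<close>: their linear parts cancel by the choice of the average.
\<close>

lemma averaged_gap_bound:
  defines "a m \<equiv> lam (Suc m) + carry m"
  defines "S m \<equiv> a m + (\<Sum>i<m. gap i)"
  defines "y m \<equiv> (a m *\<^sub>R x (Suc m) + (\<Sum>i<m. gap i *\<^sub>R x (Suc i))) /\<^sub>R S m"
  shows "f (y m) - f z \<le> energy z 0 / (2 * S m)"
proof -
  have "a m > 0"
    using lam_pos[of "Suc m"] carry_nonneg[of m] by (simp add: a_def)
  then have S: "S m > 0"
    using gap_nonneg by (simp add: S_def add_pos_nonneg sum_nonneg)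
  have "a m * (f (y m) + inner (g (y m)) (x (Suc m) - y m))
      + (\<Sum>i<m. gap i * (f (y m) + inner (g (y m)) (x (Suc i) - y m)))
      \<le> a m * f (x (Suc m)) + (\<Sum>i<m. gap i * f (x (Suc i)))"
    using subgradient gap_nonneg \<open>a m > 0\<close>
    by (intro add_mono sum_mono mult_left_mono) auto
  also have "a m * (f (y m) + inner (g (y m)) (x (Suc m) - y m))
      + (\<Sum>i<m. gap i * (f (y m) + inner (g (y m)) (x (Suc i) - y m)))
      = S m * f (y m) + inner (g (y m))
          ((a m *\<^sub>R x (Suc m) + (\<Sum>i<m. gap i *\<^sub>R x (Suc i))) - S m *\<^sub>R y m)"
    by (simp add: S_def inner_add_right inner_diff_right inner_sum_right sum.distrib
        sum_subtractf sum_distrib_left sum_distrib_right algebra_simps)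
  also have "\<dots> = S m * f (y m)"
    using S by (simp add: y_def)
  finally have "S m * f (y m) \<le> a m * f (x (Suc m)) + (\<Sum>i<m. gap i * f (x (Suc i)))" .
  then have "S m * (f (y m) - f z)
      \<le> a m * (f (x (Suc m)) - f z) + (\<Sum>i<m. gap i * (f (x (Suc i)) - f z))"
    by (simp add: S_def algebra_simps sum_subtractf sum_distrib_left)
  then have "2 * (S m * (f (y m) - f z))
      \<le> 2 * (a m * (f (x (Suc m)) - f z) + (\<Sum>i<m. gap i * (f (x (Suc i)) - f z)))"
    by simp
  also have "\<dots> \<le> energy z 0"
    unfolding a_def by (rule weighted_gap_bound)
  finally show ?thesis
    using S by (simp add: field_simps)
qed

lemma steps_sum_lower:
  assumes "\<And>k. c \<le> lam (Suc k)"
  shows "c * real (Suc m) \<le> lam (Suc m) + carry m + (\<Sum>i<m. gap i)"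
proof -
  have "c * real (Suc m) = (\<Sum>i\<le>m. c)" by simp
  also have "\<dots> \<le> (\<Sum>i\<le>m. lam (Suc i))" by (intro sum_mono assms)
  finally show ?thesis using sum_gap[of m] carry_nonneg[of 0] by linarith
qed

end

section \<open>The algorithm\<close>

lemma curvature_bound_pos: "0 < curvature_bound f y z"
  by (cases "y = z") (auto simp: curvature_bound_def)

text \<open>
  Positivity of the steps is an induction over the two preceding ones, since the growth bound
  involves their ratio; the curvature bound is positive because distinct gradients
  belong to distinct points.
\<close>

lemma adaptive_gd_imp_steps:
  assumes alg: "adaptive_gd f x lam \<theta>"
    and sub: "\<And>u v. f u + inner (grad f u) (v - u) \<le> f v"
  shows "adaptive_steps f (grad f) x lam"
    and "\<theta> (Suc k) = ereal (lam (Suc k) / lam k)"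
proof -
  define G where "G k = growth_bound (\<theta> k) (lam k)" for k
  define C where "C k = curvature_bound f (x (Suc k)) (x k)" for k
  have init: "lam 0 > 0" "\<theta> 0 = \<infinity>" "x 1 = x 0 - lam 0 *\<^sub>R grad f (x 0)"
    using alg unfolding adaptive_gd_def by blast+
  have loop: "(let m = min (growth_bound (\<theta> (k - 1)) (lam (k - 1)))
                     (curvature_bound f (x k) (x (k - 1)))
         in if m = \<infinity> then lam k > 0 else ereal (lam k) = m)"
      "x (k + 1) = x k - lam k *\<^sub>R grad f (x k)" "\<theta> k = ereal (lam k / lam (k - 1))"
    if "k \<ge> 1" for k
    using alg that unfolding adaptive_gd_def by blast+
  have step: "x (Suc k) = x k - lam k *\<^sub>R grad f (x k)" for k
    using init(3) loop(2)[of k] by (cases "k = 0") simp_all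
  show \<theta>: "\<theta> (Suc k) = ereal (lam (Suc k) / lam k)" for k
    using loop(3)[of "Suc k"] by simp
  have choice: "if min (G k) (C k) = \<infinity> then lam (Suc k) > 0
      else ereal (lam (Suc k)) = min (G k) (C k)" for k
    using loop(1)[of "Suc k"] by (simp add: Let_def G_def C_def)
  have le: "ereal (lam (Suc k)) \<le> G k" "ereal (lam (Suc k)) \<le> C k" for k
    using choice[of k] by (auto split: if_splits simp: min_def)
  have G_Suc: "G (Suc k) = ereal (sqrt (1 + lam (Suc k) / lam k) * lam (Suc k))" for k
    by (simp add: G_def growth_bound_def \<theta>)
  have lam_pos: "lam k > 0" for k
  proof (induction k rule: less_induct)
    case (less k)
    show ?case
    proof (cases k)
      case (Suc j)
      have "G j > 0"
      proof (cases j)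
        case 0
        then show ?thesis by (simp add: G_def growth_bound_def init)
      next
        case (Suc i)
        then have "lam i > 0" "lam (Suc i) > 0"
          using less \<open>k = Suc j\<close> by auto
        then show ?thesis
          by (simp add: Suc G_Suc add_pos_pos)
      qed
      moreover have "C j > 0" by (simp add: C_def curvature_bound_pos)
      ultimately have "0 < min (G j) (C j)" by simp
      then have "lam (Suc j) > 0"
        using choice[of j] by (metis ereal_less(2))
      then show ?thesis by (simp add: Suc)
    qed (simp add: init)
  qed
  show "adaptive_steps f (grad f) x lam"
  proof
    fix k
    show "lam (Suc (Suc k)) \<le> sqrt (1 + lam (Suc k) / lam k) * lam (Suc k)"
      using le(1)[of "Suc k"] by (simp add: G_Suc)
    show "2 * lam (Suc k) * norm (grad f (x (Suc k)) - grad f (x k)) \<le> norm (x (Suc k) - x k)"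
      using le(2)[of k] by (auto simp: C_def curvature_bound_def field_simps split: if_splits)
    assume dec: "lam (Suc (Suc k)) < lam (Suc k)"
    \<comment> \<open>The growth bound is at least the previous step and hence exceeds the new one, so
      the minimum is attained by the curvature bound.\<close>
    have "1 * lam (Suc k) \<le> sqrt (1 + lam (Suc k) / lam k) * lam (Suc k)"
      using lam_pos[of k] lam_pos[of "Suc k"] by (intro mult_right_mono) auto
    then have "ereal (lam (Suc (Suc k))) < G (Suc k)"
      using dec by (simp add: G_Suc)
    moreover have "min (G (Suc k)) (C (Suc k)) \<noteq> \<infinity>"
      by (auto simp: G_Suc min_def)
    ultimately have "ereal (lam (Suc (Suc k))) = C (Suc k)"
      using choice[of "Suc k"] by (auto simp: min_def split: if_splits)
    then show "grad f (x (Suc (Suc k))) \<noteq> grad f (x (Suc k)) \<and>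
        2 * lam (Suc (Suc k)) * norm (grad f (x (Suc (Suc k))) - grad f (x (Suc k)))
          = norm (x (Suc (Suc k)) - x (Suc k))"
      by (auto simp: C_def curvature_bound_def field_simps split: if_splits)
  qed (use sub lam_pos step in auto)
qed

lemma locally_lipschitz_imp_continuous_on:
  fixes h :: "'a::heine_borel \<Rightarrow> 'b::metric_space"
  assumes "locally_lipschitz h"
  shows "continuous_on UNIV h"
proof -
  have "isCont h u" for u
  proof -
    obtain L where "L-lipschitz_on (cball u 1) h"
      using assms compact_cball unfolding locally_lipschitz_def by blast
    then have "continuous_on (ball u 1) h"
      using ball_subset_cball lipschitz_on_continuous_on continuous_on_subset by blast
    then show ?thesis
      by (rule continuous_on_interior) (simp add: interior_open)
  qed
  then show ?thesis by (simp add: continuous_at_imp_continuous_on)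
qed

theorem theorem1:
  fixes f :: "real ^ 'd \<Rightarrow> real"
    and x :: "nat \<Rightarrow> real ^ 'd"
    and lam :: "nat \<Rightarrow> real"
    and \<theta> :: "nat \<Rightarrow> ereal"
  assumes "convex_on UNIV f"
    and "f differentiable_on UNIV"
    and "locally_lipschitz (grad f)"
    and "\<exists>z. is_solution f z"
    and "adaptive_gd f x lam \<theta>"
  shows "(\<exists>z. is_solution f z \<and> x \<longlonglongrightarrow> z) \<and>
    (\<forall>k\<ge>1. weight_sum lam \<theta> k = (\<Sum>i=1..k. lam i) + lam 1 * real_of_ereal (\<theta> 1)) \<and>
    (\<forall>z. is_solution f z \<longrightarrow>
       (\<forall>k\<ge>1. f (averaged_iterate x lam \<theta> k) - opt_value f
                 \<le> init_const f x lam \<theta> z / (2 * weight_sum lam \<theta> k)) \<and>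
       (\<lambda>k. init_const f x lam \<theta> z / (2 * weight_sum lam \<theta> k)) \<in> O(\<lambda>k. 1 / real k))"
proof -
  have deriv: "GDERIV f u :> grad f u" for u
    using assms(2) by (intro GDERIV_grad) (simp add: differentiable_on_def)
  have cont: "continuous_on UNIV (grad f)"
    using assms(3) by (rule locally_lipschitz_imp_continuous_on)
  note steps = adaptive_gd_imp_steps[OF assms(5) convex_above_tangent[OF assms(1) deriv]]
  interpret adaptive_steps f "grad f" x lam by (rule steps(1))

  have solution_iff: "is_solution f z \<longleftrightarrow> (\<forall>v. f z \<le> f v)" for z
    by (auto simp: is_solution_def is_arg_min_linorder)
  have opt: "opt_value f = f z" if "is_solution f z" for z
    unfolding opt_value_def
    by (rule cInf_eq_minimum) (use that in \<open>auto simp: solution_iff\<close>)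

  have past: "lam (Suc k) * real_of_ereal (\<theta> (Suc k)) = carry k" for k
    by (simp add: steps(2) carry_def power2_eq_square)
  have coeff: "lam (Suc k) * (1 + real_of_ereal (\<theta> (Suc k))) = lam (Suc k) + carry k" for k
    by (simp add: past ring_distribs)
  have weight: "weight lam \<theta> (Suc i) = gap i" for i
    by (simp add: weight_def coeff past gap_def)
  have wsum: "weight_sum lam \<theta> (Suc m) = lam (Suc m) + carry m + (\<Sum>i<m. gap i)" for m
    by (simp add: weight_sum_def coeff sum.atLeast1_atMost_eq weight)
  have avg: "averaged_iterate x lam \<theta> (Suc m)
      = ((lam (Suc m) + carry m) *\<^sub>R x (Suc m) + (\<Sum>i<m. gap i *\<^sub>R x (Suc i)))
          /\<^sub>R (lam (Suc m) + carry m + (\<Sum>i<m. gap i))" for m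
    by (simp add: averaged_iterate_def wsum coeff sum.atLeast1_atMost_eq weight)
  have init: "init_const f x lam \<theta> z = energy z 0" if "is_solution f z" for z
    using past[of 0] by (simp add: init_const_def energy_def opt[OF that] mult.assoc)

  obtain z0 where "is_solution f z0" using assms(4) by blast
  then have z0: "\<And>v. f z0 \<le> f v" by (simp add: solution_iff)
  have bdd: "bounded (range x)" using bounded_iterates[OF z0] .
  \<comment> \<open>Bounded iterates stay in a compact set, where the local Lipschitz property gives one constant.\<close>
  obtain L where "L-lipschitz_on (closure (range x)) (grad f)"
    using assms(3) bdd unfolding locally_lipschitz_def by (meson compact_closure)
  then have "L-lipschitz_on (range x) (grad f)"
    by (rule lipschitz_on_subset) (rule closure_subset)
  then obtain c where c: "c > 0" "\<And>k. c \<le> lam (Suc k)"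
    using steps_bounded_below by blast

  have "\<exists>z\<in>{z. is_solution f z}. (\<lambda>k. x (Suc k)) \<longlonglongrightarrow> z"
  proof (rule opial_LIMSEQ)
    show "bounded (range (\<lambda>k. x (Suc k)))"
      using bdd by (rule bounded_subset) auto
  next
    fix r l
    assume r: "strict_mono r" and l: "((\<lambda>k. x (Suc k)) \<circ> r) \<longlonglongrightarrow> l"
    have "f l \<le> f v" for v
      by (rule cluster_point_minimal[OF deriv cont z0 bregman_tendsto_zero[OF z0 c],
            of "\<lambda>k. Suc (r k)"])
         (use r l in \<open>auto simp: strict_mono_def o_def\<close>)
    then show "l \<in> {z. is_solution f z}" by (simp add: solution_iff)
  next
    fix z assume "z \<in> {z. is_solution f z}"
    then have z: "is_solution f z" by simp
    have "convergent (energy z)"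
      by (rule convergent_energy) (use z in \<open>simp add: solution_iff\<close>)
    then show "convergent (\<lambda>k. (norm (x (Suc k) - z))\<^sup>2
        + (1 / 2 * (norm (x (Suc k) - x k))\<^sup>2 + 2 * carry k * (f (x k) - opt_value f)))"
      by (simp add: energy_def[abs_def] opt[OF z] add.assoc)
  qed
  then have "\<exists>z. is_solution f z \<and> x \<longlonglongrightarrow> z"
    using filterlim_sequentially_Suc by blast
  moreover have "weight_sum lam \<theta> k = (\<Sum>i=1..k. lam i) + lam 1 * real_of_ereal (\<theta> 1)"
    if pos: "k \<ge> 1" for k
  proof -
    obtain m where k: "k = Suc m" using pos by (cases k) auto
    have "(\<Sum>i=1..k. lam i) = (\<Sum>i\<le>m. lam (Suc i))"
      by (simp add: k sum.atLeast1_atMost_eq lessThan_Suc_atMost[symmetric])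
    then show ?thesis
      using past[of 0] sum_gap[of m] by (simp add: k wsum)
  qed
  moreover have "f (averaged_iterate x lam \<theta> k) - opt_value f
      \<le> init_const f x lam \<theta> z / (2 * weight_sum lam \<theta> k)"
    if z: "is_solution f z" and pos: "k \<ge> 1" for z k
  proof -
    obtain m where k: "k = Suc m" using pos by (cases k) auto
    show ?thesis
      unfolding k avg wsum init[OF z] opt[OF z] by (rule averaged_gap_bound)
  qed
  moreover have "(\<lambda>k. init_const f x lam \<theta> z / (2 * weight_sum lam \<theta> k)) \<in> O(\<lambda>k. 1 / real k)"
    if z: "is_solution f z" for z
  proof (rule bigoI[where c = "energy z 0 / (2 * c)"])
    have E: "energy z 0 \<ge> 0"
      by (rule energy_nonneg) (use z in \<open>simp add: solution_iff\<close>)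
    have "norm (init_const f x lam \<theta> z / (2 * weight_sum lam \<theta> k))
        \<le> energy z 0 / (2 * c) * norm (1 / real k)" if pos: "k \<ge> 1" for k
    proof -
      obtain m where k: "k = Suc m" using pos by (cases k) auto
      have S: "c * real k \<le> weight_sum lam \<theta> k" and "c * real k > 0"
        using steps_sum_lower[OF c(2), of m] c(1) by (auto simp: k wsum)
      then have "energy z 0 / (2 * weight_sum lam \<theta> k) \<le> energy z 0 / (2 * (c * real k))"
        using E by (intro divide_left_mono) auto
      then show ?thesis
        using E S \<open>c * real k > 0\<close> by (simp add: init[OF z])
    qed
    then show "\<forall>\<^sub>F k in sequentially. norm (init_const f x lam \<theta> z / (2 * weight_sum lam \<theta> k))
        \<le> energy z 0 / (2 * c) * norm (1 / real k)"
      by (rule eventually_sequentiallyI)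
  qed
  ultimately show ?thesis by blast
qed

end
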